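(* Let $G$ be a group, $H$ a finite index subgroup of $G$, $\overline H=\bigcap_{g\in G}gHg^{-1}$, $Q=G/\overline H$, let $\vartheta:G\to\mathrm{Aut}(\overline H)$ be the homomorphism $\vartheta(g)(k)=gkg^{-1}$, and let $\Theta:Q\to\mathrm{Out}(\overline H)$ be the homomorphism induced by $\vartheta$. Then the following are equivalent: (1) $G$ is icc; (2) $H$ is icc and $\Theta:Q\to\mathrm{Out}(\overline H)$ is injective; (3) $H$ is icc and for every $g\in G\setminus H$ of finite order, $\vartheta(g)$ is not the identity; (4) $H$ is icc and for every $g\in G\setminus H$ of finite order, $\vartheta(g)$ is not an inner automorphism of $\overline H$.
   Context: A group is icc if it is infinite and all of its conjugacy classes except $\{1\}$ are infinite. *)

theory Defs
  imports "HOL-Algebra.Algebra"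
begin

definition conjugacy_classes :: "('a, 'b) monoid_scheme \<Rightarrow> 'a set set" where
  "conjugacy_classes G =
     orbits G (carrier G) (\<lambda>g. \<lambda>h \<in> carrier G. g \<otimes>\<^bsub>G\<^esub> h \<otimes>\<^bsub>G\<^esub> inv\<^bsub>G\<^esub> g)"

definition icc :: "('a, 'b) monoid_scheme \<Rightarrow> bool" where
  "icc G \<longleftrightarrow> infinite (carrier G) \<and> (\<forall>C \<in> conjugacy_classes G - {{\<one>\<^bsub>G\<^esub>}}. infinite C)"

definition normal_core :: "('a, 'b) monoid_scheme \<Rightarrow> 'a set \<Rightarrow> 'a set" where
  "normal_core G H = (\<Inter>g \<in> carrier G. g <#\<^bsub>G\<^esub> H #>\<^bsub>G\<^esub> inv\<^bsub>G\<^esub> g)"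

text \<open>The library function \<open>ord\<close> takes the value 0 exactly at the elements of infinite order.\<close>

definition has_finite_order :: "('a, 'b) monoid_scheme \<Rightarrow> 'a \<Rightarrow> bool" where
  "has_finite_order G g \<longleftrightarrow> group.ord G g \<noteq> 0"

text \<open>
  For a normal subgroup \<open>N\<close>, \<open>conj_aut G N\<close> is the homomorphism from \<open>G\<close> to \<open>Aut(N)\<close> given by
  conjugation.  As required by \<^const>\<open>AutoGroup\<close>, the automorphisms are extensional functions,
  with value \<open>undefined\<close> outside \<open>N\<close>.
\<close>

definition conj_aut :: "('a, 'b) monoid_scheme \<Rightarrow> 'a set \<Rightarrow> 'a \<Rightarrow> 'a \<Rightarrow> 'a" where
  "conj_aut G N g = (\<lambda>k \<in> N. g \<otimes>\<^bsub>G\<^esub> k \<otimes>\<^bsub>G\<^esub> inv\<^bsub>G\<^esub> g)"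

definition Inn :: "('a, 'b) monoid_scheme \<Rightarrow> ('a \<Rightarrow> 'a) set" where
  "Inn K = conj_aut K (carrier K) ` carrier K"

definition Out :: "('a, 'b) monoid_scheme \<Rightarrow> ('a \<Rightarrow> 'a) set monoid" where
  "Out K = AutoGroup K Mod Inn K"

text \<open>
  The map \<open>G/N \<rightarrow> Out(N)\<close> induced by \<^const>\<open>conj_aut\<close>, for a normal subgroup \<open>N\<close>.  The image of
  a coset \<open>C\<close> under \<open>g \<mapsto> Inn(N) \<vartheta>(g)\<close> is a singleton, so that \<^const>\<open>the_elem\<close> is meaningful
  (lemma \<open>out_map_coset\<close> below).
\<close>

definition out_map :: "('a, 'b) monoid_scheme \<Rightarrow> 'a set \<Rightarrow> 'a set \<Rightarrow> ('a \<Rightarrow> 'a) set" where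
  "out_map G N C =
     the_elem ((\<lambda>g. Inn (G\<lparr>carrier := N\<rparr>)
                     #>\<^bsub>AutoGroup (G\<lparr>carrier := N\<rparr>)\<^esub> conj_aut G N g) ` C)"

lemma (in group) inv_cancel_left:
  assumes "x \<in> carrier G" "y \<in> carrier G"
  shows "x \<otimes> (inv x \<otimes> y) = y" "inv x \<otimes> (x \<otimes> y) = y"
  using assms by (simp_all add: m_assoc[symmetric])

lemma (in group) normal_core_normal:
  assumes "subgroup H G"
  shows "normal_core G H \<lhd> G"
proof -
  have conj: "g <# H #> inv g = {x \<in> carrier G. inv g \<otimes> x \<otimes> g \<in> H}" if g: "g \<in> carrier G" for g
  proof (intro equalityI subsetI)
    fix x assume "x \<in> g <# H #> inv g"
    then obtain h where h: "h \<in> H" "x = g \<otimes> h \<otimes> inv g"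
      by (auto simp: l_coset_def r_coset_def)
    have hc: "h \<in> carrier G" using h assms by (meson subgroup.mem_carrier)
    have "inv g \<otimes> (g \<otimes> h \<otimes> inv g) \<otimes> g = h"
      using g hc by (simp add: m_assoc inv_cancel_left)
    then show "x \<in> {x \<in> carrier G. inv g \<otimes> x \<otimes> g \<in> H}"
      using g hc h by simp
  next
    fix x assume x: "x \<in> {x \<in> carrier G. inv g \<otimes> x \<otimes> g \<in> H}"
    then have "x = g \<otimes> (inv g \<otimes> x \<otimes> g) \<otimes> inv g"
      using g by (simp add: conjugation_is_surj)
    then show "x \<in> g <# H #> inv g"
      using x by (auto simp: l_coset_def r_coset_def)
  qed
  have core: "normal_core G H = {x \<in> carrier G. \<forall>g \<in> carrier G. inv g \<otimes> x \<otimes> g \<in> H}"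
    unfolding normal_core_def using conj by auto
  have sub: "subgroup (normal_core G H) G"
  proof (rule subgroupI)
    show "normal_core G H \<subseteq> carrier G" by (auto simp: core)
    have "\<one> \<in> normal_core G H" by (simp add: core subgroup.one_closed[OF assms])
    then show "normal_core G H \<noteq> {}" by blast
  next
    fix a assume a: "a \<in> normal_core G H"
    have "inv g \<otimes> inv a \<otimes> g \<in> H" if g: "g \<in> carrier G" for g
    proof -
      have "inv (inv g \<otimes> a \<otimes> g) \<in> H"
        using a g core subgroup.m_inv_closed[OF assms] by auto
      moreover have "inv (inv g \<otimes> a \<otimes> g) = inv g \<otimes> inv a \<otimes> g"
        using a g by (simp add: core inv_mult_group m_assoc)
      ultimately show ?thesis by simp
    qed
    then show "inv a \<in> normal_core G H" using a by (simp add: core)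
  next
    fix a b assume a: "a \<in> normal_core G H" and b: "b \<in> normal_core G H"
    have "inv g \<otimes> (a \<otimes> b) \<otimes> g \<in> H" if g: "g \<in> carrier G" for g
    proof -
      have "(inv g \<otimes> a \<otimes> g) \<otimes> (inv g \<otimes> b \<otimes> g) \<in> H"
        using a b g core subgroup.m_closed[OF assms] by auto
      moreover have "(inv g \<otimes> a \<otimes> g) \<otimes> (inv g \<otimes> b \<otimes> g) = inv g \<otimes> (a \<otimes> b) \<otimes> g"
        using a b g by (simp add: core m_assoc inv_cancel_left)
      ultimately show ?thesis by simp
    qed
    then show "a \<otimes> b \<in> normal_core G H" using a b by (simp add: core)
  qed
  have "x \<otimes> h \<otimes> inv x \<in> normal_core G H"
    if x: "x \<in> carrier G" and h: "h \<in> normal_core G H" for x h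
  proof -
    have hc: "h \<in> carrier G" using h core by auto
    have "inv g \<otimes> (x \<otimes> h \<otimes> inv x) \<otimes> g \<in> H" if g: "g \<in> carrier G" for g
    proof -
      have "inv (inv x \<otimes> g) \<otimes> h \<otimes> (inv x \<otimes> g) \<in> H" using h x g core by auto
      then show ?thesis using x g hc by (simp add: inv_mult_group m_assoc)
    qed
    then show ?thesis using x hc by (simp add: core)
  qed
  then show ?thesis using sub normal_inv_iff by blast
qed

lemma (in normal) conj_aut_hom: "conj_aut G H \<in> hom G (AutoGroup (G\<lparr>carrier := H\<rparr>))"
proof -
  have cl: "g \<otimes> k \<otimes> inv g \<in> H" if "g \<in> carrier G" "k \<in> H" for g k
    using that inv_op_closed2 by simp
  have mc: "k \<in> H \<Longrightarrow> k \<in> carrier G" for k by (rule mem_carrier)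
  have bij: "bij_betw (conj_aut G H g) H H" if g: "g \<in> carrier G" for g
  proof (rule bij_betw_byWitness[where f' = "conj_aut G H (inv g)"])
    show "\<forall>a\<in>H. conj_aut G H (inv g) (conj_aut G H g a) = a"
      using g cl mc conjugation_is_surj[of "inv g"] by (simp add: conj_aut_def)
    show "\<forall>a\<in>H. conj_aut G H g (conj_aut G H (inv g) a) = a"
      using g cl[of "inv g"] mc conjugation_is_surj[of g] by (simp add: conj_aut_def)
    show "conj_aut G H g ` H \<subseteq> H" "conj_aut G H (inv g) ` H \<subseteq> H"
      using g cl cl[of "inv g"] by (auto simp: conj_aut_def)
  qed
  have hom: "conj_aut G H g \<in> hom (G\<lparr>carrier := H\<rparr>) (G\<lparr>carrier := H\<rparr>)" if g: "g \<in> carrier G" for g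
  proof (rule homI)
    fix x assume "x \<in> carrier (G\<lparr>carrier := H\<rparr>)"
    then show "conj_aut G H g x \<in> carrier (G\<lparr>carrier := H\<rparr>)" using g cl by (simp add: conj_aut_def)
  next
    fix x y assume "x \<in> carrier (G\<lparr>carrier := H\<rparr>)" "y \<in> carrier (G\<lparr>carrier := H\<rparr>)"
    then have xy: "x \<in> H" "y \<in> H" by auto
    have "g \<otimes> (x \<otimes> y) \<otimes> inv g = (g \<otimes> x \<otimes> inv g) \<otimes> (g \<otimes> y \<otimes> inv g)"
      using g mc[OF xy(1)] mc[OF xy(2)]
      by (simp add: m_assoc inv_cancel_left)
    then show "conj_aut G H g (x \<otimes>\<^bsub>G\<lparr>carrier := H\<rparr>\<^esub> y)
        = conj_aut G H g x \<otimes>\<^bsub>G\<lparr>carrier := H\<rparr>\<^esub> conj_aut G H g y"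
      using xy by (simp add: conj_aut_def)
  qed
  have aut: "conj_aut G H g \<in> auto (G\<lparr>carrier := H\<rparr>)" if g: "g \<in> carrier G" for g
    using hom[OF g] bij[OF g] by (auto simp: auto_def Bij_def conj_aut_def)
  show ?thesis
  proof (rule homI)
    fix x assume "x \<in> carrier G"
    then show "conj_aut G H x \<in> carrier (AutoGroup (G\<lparr>carrier := H\<rparr>))"
      using aut by (simp add: AutoGroup_def)
  next
    fix x y assume x: "x \<in> carrier G" and y: "y \<in> carrier G"
    have b: "conj_aut G H x \<in> Bij H" "conj_aut G H y \<in> Bij H"
      using aut[OF x] aut[OF y] by (auto simp: auto_def)
    have "conj_aut G H (x \<otimes> y) = compose H (conj_aut G H x) (conj_aut G H y)"
      using x y cl mc by (auto simp: conj_aut_def compose_def inv_mult_group m_assoc)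
    then show "conj_aut G H (x \<otimes> y)
        = conj_aut G H x \<otimes>\<^bsub>AutoGroup (G\<lparr>carrier := H\<rparr>)\<^esub> conj_aut G H y"
      using b by (simp add: AutoGroup_def BijGroup_def)
  qed
qed

lemma (in group) Inn_normal: "Inn G \<lhd> AutoGroup G"
proof -
  interpret N: normal "carrier G" G by (rule normal_invI) (auto simp: subgroup_self)
  interpret A: group "AutoGroup G" by (rule AutoGroup)
  have hom: "conj_aut G (carrier G) \<in> hom G (AutoGroup G)"
    using N.conj_aut_hom by simp
  interpret c: group_hom G "AutoGroup G" "conj_aut G (carrier G)"
    using hom by unfold_locales
  have sub: "subgroup (Inn G) (AutoGroup G)"
    unfolding Inn_def using c.img_is_subgroup .
  have "f \<otimes>\<^bsub>AutoGroup G\<^esub> h \<otimes>\<^bsub>AutoGroup G\<^esub> inv\<^bsub>AutoGroup G\<^esub> f \<in> Inn G"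
    if f: "f \<in> carrier (AutoGroup G)" and h: "h \<in> Inn G" for f h
  proof -
    obtain g where g: "g \<in> carrier G" "h = conj_aut G (carrier G) g" using h by (auto simp: Inn_def)
    have fh: "f \<in> hom G G" and fB: "f \<in> Bij (carrier G)" using f by (auto simp: AutoGroup_def auto_def)
    interpret f: group_hom G G f using fh by unfold_locales
    have fg: "f g \<in> carrier G" using g by simp
    have cB: "conj_aut G (carrier G) x \<in> Bij (carrier G)" if "x \<in> carrier G" for x
      using hom_in_carrier[OF hom that] by (auto simp: AutoGroup_def auto_def)
    have "f \<otimes>\<^bsub>AutoGroup G\<^esub> h = conj_aut G (carrier G) (f g) \<otimes>\<^bsub>AutoGroup G\<^esub> f"
      using fB cB g fg by (auto simp: AutoGroup_def BijGroup_def compose_def conj_aut_def)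
    then have "f \<otimes>\<^bsub>AutoGroup G\<^esub> h \<otimes>\<^bsub>AutoGroup G\<^esub> inv\<^bsub>AutoGroup G\<^esub> f = conj_aut G (carrier G) (f g)"
      using f fg hom_in_carrier[OF hom fg] by (simp add: A.m_assoc)
    then show ?thesis using fg by (simp add: Inn_def)
  qed
  then show ?thesis using sub A.normal_inv_iff by blast
qed

lemma (in normal) out_map_coset:
  assumes g: "g \<in> carrier G"
  shows "out_map G H (H #> g)
    = Inn (G\<lparr>carrier := H\<rparr>) #>\<^bsub>AutoGroup (G\<lparr>carrier := H\<rparr>)\<^esub> conj_aut G H g"
proof -
  let ?K = "G\<lparr>carrier := H\<rparr>"
  interpret K: group ?K using subgroup_axioms subgroup_is_group[OF is_group] by simp
  interpret A: group "AutoGroup ?K" by (rule K.AutoGroup)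
  interpret I: normal "Inn ?K" "AutoGroup ?K" by (rule K.Inn_normal)
  have eq: "Inn ?K #>\<^bsub>AutoGroup ?K\<^esub> conj_aut G H x = Inn ?K #>\<^bsub>AutoGroup ?K\<^esub> conj_aut G H g"
    if x: "x \<in> H #> g" for x
  proof -
    obtain h where h: "h \<in> H" "x = h \<otimes> g" using x by (auto simp: r_coset_def)
    have hc: "h \<in> carrier G" using h(1) by (rule mem_carrier)
    have "conj_aut G H h = conj_aut ?K (carrier ?K) h"
      using h by (auto simp: conj_aut_def m_inv_consistent[OF subgroup_axioms])
    then have "conj_aut G H h \<in> Inn ?K" using h by (auto simp: Inn_def)
    moreover have "conj_aut G H x = conj_aut G H h \<otimes>\<^bsub>AutoGroup ?K\<^esub> conj_aut G H g"
      using hom_mult[OF conj_aut_hom hc g] h by simp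
    ultimately have "conj_aut G H x \<in> Inn ?K #>\<^bsub>AutoGroup ?K\<^esub> conj_aut G H g"
      by (auto simp: r_coset_def)
    from A.repr_independence[OF this hom_in_carrier[OF conj_aut_hom g] I.subgroup_axioms]
    show ?thesis by (rule sym)
  qed
  have "g \<in> H #> g" using g by (rule rcos_self) (rule subgroup_axioms)
  then have "the_elem ((\<lambda>x. Inn ?K #>\<^bsub>AutoGroup ?K\<^esub> conj_aut G H x) ` (H #> g))
      = Inn ?K #>\<^bsub>AutoGroup ?K\<^esub> conj_aut G H g"
    by (intro the_elem_image_unique eq) auto
  then show ?thesis by (simp only: out_map_def)
qed

lemma (in normal) out_map_hom: "out_map G H \<in> hom (G Mod H) (Out (G\<lparr>carrier := H\<rparr>))"
proof -
  let ?K = "G\<lparr>carrier := H\<rparr>"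
  interpret K: group ?K using subgroup_axioms subgroup_is_group[OF is_group] by simp
  interpret I: normal "Inn ?K" "AutoGroup ?K" by (rule K.Inn_normal)
  note c = hom_in_carrier[OF conj_aut_hom]
  show ?thesis
  proof (rule homI)
    fix C assume "C \<in> carrier (G Mod H)"
    then obtain x where "x \<in> carrier G" "C = H #> x" by (auto simp: FactGroup_def RCOSETS_def)
    then show "out_map G H C \<in> carrier (Out ?K)"
      using c by (auto simp: out_map_coset Out_def FactGroup_def RCOSETS_def)
  next
    fix C D assume "C \<in> carrier (G Mod H)" "D \<in> carrier (G Mod H)"
    then obtain x y where xy: "x \<in> carrier G" "C = H #> x" "y \<in> carrier G" "D = H #> y"
      by (auto simp: FactGroup_def RCOSETS_def)
    then show "out_map G H (C \<otimes>\<^bsub>G Mod H\<^esub> D) = out_map G H C \<otimes>\<^bsub>Out ?K\<^esub> out_map G H D"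
      using c by (simp add: Out_def rcos_sum I.rcos_sum out_map_coset hom_mult[OF conj_aut_hom])
  qed
qed

end

theory Submission
  imports Defs
begin

text \<open>
  Call an element of \<open>G\<close> FC if its conjugacy class is finite.  An element whose conjugates by a
  finite index subgroup are finitely many is FC.  Hence \<open>H\<close> inherits icc from \<open>G\<close>, and an element
  acting on the core \<open>N\<close> like some \<open>n \<in> N\<close> differs from \<open>n\<close> by an FC element, as \<open>N\<close> has
  finite index too.  Conversely, if \<open>H\<close> is icc, then it contains no FC element other than \<open>\<one>\<close>.
  For an FC element \<open>g \<noteq> \<one>\<close>, some positive power of \<open>g\<close> and all commutators of \<open>g\<close> with \<open>N\<close> are
  FC elements in \<open>H\<close>; so \<open>g\<close> has finite order and centralizes \<open>N\<close>, while \<open>g \<notin> H\<close>.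
\<close>

section \<open>Icc in terms of FC elements\<close>

abbreviation conj_by :: "('a, 'b) monoid_scheme \<Rightarrow> 'a \<Rightarrow> 'a \<Rightarrow> 'a" where
  "conj_by G x g \<equiv> g \<otimes>\<^bsub>G\<^esub> x \<otimes>\<^bsub>G\<^esub> inv\<^bsub>G\<^esub> g"

text \<open>Conjugating by \<open>\<one>\<close> shows that \<open>x\<close> lies in its own class,
  so only \<open>\<one>\<close> has the class excluded in the definition. This trades classes for
  elements.\<close>

lemma (in group) icc_iff:
  "icc G \<longleftrightarrow> infinite (carrier G) \<and>
     (\<forall>x \<in> carrier G. finite (conj_by G x ` carrier G) \<longrightarrow> x = \<one>)"
proof -
  define cl where "cl = (\<lambda>x. conj_by G x ` carrier G)"
  have "conjugacy_classes G = cl ` carrier G"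
    by (auto simp: cl_def conjugacy_classes_def orbits_def orbit_def)
  moreover have "cl x = {\<one>} \<longleftrightarrow> x = \<one>" if "x \<in> carrier G" for x
  proof
    assume "cl x = {\<one>}"
    then have "conj_by G x \<one> = \<one>" unfolding cl_def by blast
    then show "x = \<one>" using that by simp
  next
    assume "x = \<one>"
    then show "cl x = {\<one>}" unfolding cl_def by force
  qed
  ultimately have "icc G \<longleftrightarrow> infinite (carrier G) \<and> (\<forall>x \<in> carrier G. finite (cl x) \<longrightarrow> x = \<one>)"
    by (auto simp: icc_def)
  then show ?thesis by (simp only: cl_def)
qed

text \<open>Inverses in \<open>H\<close> and in \<open>G\<close> agree, so classes in
  \<open>H\<close> can be compared with classes in \<open>G\<close> without leaving the operations
  of \<open>G\<close>.\<close>

lemma (in group) icc_subgroup_iff: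
  assumes "subgroup H G"
  shows "icc (G\<lparr>carrier := H\<rparr>) \<longleftrightarrow>
    infinite H \<and> (\<forall>x \<in> H. finite (conj_by G x ` H) \<longrightarrow> x = \<one>)"
proof -
  interpret K: group "G\<lparr>carrier := H\<rparr>" using assms by (rule subgroup_imp_group)
  have "conj_by (G\<lparr>carrier := H\<rparr>) x ` H = conj_by G x ` H" for x
    by (rule image_cong) (simp_all add: m_inv_consistent[OF assms])
  then show ?thesis by (simp add: K.icc_iff)
qed

section \<open>Finite index subgroups and the normal core\<close>

lemma (in group) finite_index_transversal:
  assumes "subgroup K G" "finite (rcosets K)"
  obtains R where "finite R" "R \<subseteq> carrier G" "\<And>g. g \<in> carrier G \<Longrightarrow> \<exists>k\<in>K. \<exists>r\<in>R. g = k \<otimes> r"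
proof -
  obtain R where R: "R \<subseteq> carrier G" "finite R" "rcosets K = (\<lambda>r. K #> r) ` R"
    using finite_subset_image[OF assms(2), of "\<lambda>r. K #> r" "carrier G"]
    by (auto simp: RCOSETS_def UNION_singleton_eq_range)
  have "\<exists>k\<in>K. \<exists>r\<in>R. g = k \<otimes> r" if g: "g \<in> carrier G" for g
  proof -
    have "K #> g \<in> (\<lambda>r. K #> r) ` R" using R(3) g by (auto simp: RCOSETS_def)
    then obtain r where "r \<in> R" "g \<in> K #> r" using rcos_self[OF g assms(1)] by auto
    then show ?thesis by (auto simp: r_coset_def)
  qed
  with R that show thesis by blast
qed

text \<open>With a finite transversal \<open>R\<close>, the class of \<open>x\<close> is covered by
  the conjugates of the finite \<open>K\<close>-orbit of \<open>x\<close> by the inverses of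
  elements of \<open>R\<close>.\<close>

lemma (in group) finite_conj_class_if_finite_index:
  assumes "subgroup K G" "finite (rcosets K)" and x: "x \<in> carrier G"
    and fin: "finite (conj_by G x ` K)"
  shows "finite (conj_by G x ` carrier G)"
proof -
  obtain R where R: "finite R" "R \<subseteq> carrier G"
      "\<And>g. g \<in> carrier G \<Longrightarrow> \<exists>k\<in>K. \<exists>r\<in>R. g = k \<otimes> r"
    using finite_index_transversal[OF assms(1,2)] by metis
  have "conj_by G x ` carrier G \<subseteq> (\<Union>r\<in>R. (\<lambda>y. inv r \<otimes> y \<otimes> r) ` conj_by G x ` K)"
  proof
    fix y assume "y \<in> conj_by G x ` carrier G"
    then obtain g where g: "g \<in> carrier G" "y = conj_by G x g" by blast
    \<comment> \<open>The factor from \<open>K\<close> has to stand next to \<open>x\<close> in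
      \<open>g x g^-1\<close>. Right cosets put it on the left, so it is \<open>inv g\<close> that
      gets decomposed.\<close>
    obtain k r where kr: "k \<in> K" "r \<in> R" "inv g = k \<otimes> r" using R(3)[of "inv g"] g by auto
    have c: "k \<in> carrier G" "r \<in> carrier G" using kr R(2) assms(1) subgroup.mem_carrier by auto
    have "g = inv r \<otimes> inv k" using kr(3) c g by (metis inv_inv inv_mult_group)
    then have "y = inv r \<otimes> conj_by G x (inv k) \<otimes> r"
      using c g x by (simp add: m_assoc inv_mult_group)
    moreover have "inv k \<in> K" using kr assms(1) by (simp add: subgroup.m_inv_closed)
    ultimately show "y \<in> (\<Union>r\<in>R. (\<lambda>y. inv r \<otimes> y \<otimes> r) ` conj_by G x ` K)" using kr by blast
  qed
  then show ?thesis by (rule finite_subset) (use R fin in blast)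
qed

lemma (in group) normal_core_subset:
  assumes "subgroup H G"
  shows "normal_core G H \<subseteq> H"
proof -
  have "normal_core G H \<subseteq> \<one> <# H #> inv \<one>" unfolding normal_core_def by (rule INT_lower) simp
  also have "\<dots> = H"
    using subgroup.subset[OF assms] by (simp add: lcos_mult_one)
  finally show ?thesis .
qed

text \<open>As \<open>g\<close> runs through \<open>G\<close>, so does \<open>inv g\<close>; hence
  \<open>x\<close> lies in every conjugate of \<open>H\<close> once every conjugate of
  \<open>x\<close> lies in \<open>H\<close>.\<close>

lemma (in group) normal_coreI:
  assumes "x \<in> carrier G" "\<And>g. g \<in> carrier G \<Longrightarrow> g \<otimes> x \<otimes> inv g \<in> H"
  shows "x \<in> normal_core G H"
  unfolding normal_core_def
proof
  fix g assume g: "g \<in> carrier G"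
  have "x = g \<otimes> (inv g \<otimes> x \<otimes> g) \<otimes> inv g" using assms(1) g by (simp add: conjugation_is_surj)
  moreover have "inv g \<otimes> x \<otimes> g \<in> H" using assms(2)[of "inv g"] g by simp
  ultimately show "x \<in> g <# H #> inv g" by (auto simp: l_coset_def r_coset_def)
qed

lemma (in group) finite_index_normal_core:
  assumes H: "subgroup H G" and fin: "finite (rcosets H)"
  shows "finite (rcosets (normal_core G H))"
proof -
  let ?N = "normal_core G H"
  interpret N: normal ?N G using H by (rule normal_core_normal)
  \<comment> \<open>The action of \<open>G\<close> by permutations of the finite set of cosets of \<open>H\<close> has kernel \<open>N\<close>.\<close>
  define act where "act = (\<lambda>x. \<lambda>C\<in>rcosets H. C #> x)"
  have "act ` carrier G \<subseteq> rcosets H \<rightarrow>\<^sub>E rcosets H"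
  proof
    fix f assume "f \<in> act ` carrier G"
    then obtain x where x: "x \<in> carrier G" "f = act x" by blast
    have "C #> x \<in> rcosets H" if "C \<in> rcosets H" for C
      using that x subgroup.subset[OF H] by (auto simp: RCOSETS_def coset_mult_assoc)
    then show "f \<in> rcosets H \<rightarrow>\<^sub>E rcosets H" using x by (auto simp: act_def)
  qed
  then have fin_act: "finite (act ` carrier G)"
    by (rule finite_subset) (simp add: finite_PiE fin)
  \<comment> \<open>Comparing \<open>act x\<close> and \<open>act y\<close> at the coset
    \<open>H #> g\<close> puts the conjugate of \<open>x \<otimes> inv y\<close> by \<open>g\<close>
    into \<open>H\<close>, for every \<open>g\<close>.\<close>
  have eq: "?N #> x = ?N #> y" if x: "x \<in> carrier G" and y: "y \<in> carrier G" and xy: "act x = act y" for x y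
  proof -
    have "x \<otimes> inv y \<in> ?N"
    proof (rule normal_coreI)
      fix g assume g: "g \<in> carrier G"
      have "H #> g \<in> rcosets H" using g by (auto simp: RCOSETS_def)
      then have "H #> g #> x = H #> g #> y" using fun_cong[OF xy, of "H #> g"] by (simp add: act_def)
      then have "H #> (g \<otimes> x) = H #> (g \<otimes> y)"
        using g x y subgroup.subset[OF H] by (simp add: coset_mult_assoc)
      then have "g \<otimes> x \<in> H #> (g \<otimes> y)" using rcos_self[OF _ H, of "g \<otimes> x"] g x by simp
      then have "(g \<otimes> x) \<otimes> inv (g \<otimes> y) \<in> H"
        using subgroup.rcos_module[OF H is_group] g x y by simp
      then show "g \<otimes> (x \<otimes> inv y) \<otimes> inv g \<in> H" using g x y by (simp add: m_assoc inv_mult_group)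
    qed (use x y in simp)
    then have "x \<in> ?N #> y" using N.rcos_module[OF is_group] x y by simp
    then show ?thesis using repr_independence[OF _ y N.subgroup_axioms] by simp
  qed
  \<comment> \<open>By \<open>eq\<close>, a coset of the core is determined by the value of
    \<open>act\<close>, whichever preimage \<open>inv_into\<close> picks; so there are at most as
    many cosets as values.\<close>
  have "rcosets ?N \<subseteq> (\<lambda>f. ?N #> inv_into (carrier G) act f) ` act ` carrier G"
  proof
    fix C assume "C \<in> rcosets ?N"
    then obtain x where x: "x \<in> carrier G" "C = ?N #> x" by (auto simp: RCOSETS_def)
    have "?N #> inv_into (carrier G) act (act x) = C"
      unfolding x(2) using x(1) by (intro eq inv_into_into f_inv_into_f) auto
    then show "C \<in> (\<lambda>f. ?N #> inv_into (carrier G) act f) ` act ` carrier G" using x by blast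
  qed
  then show ?thesis by (rule finite_subset) (use fin_act in blast)
qed

section \<open>Closure properties of FC elements, and powers modulo finite index\<close>

lemma (in group) conj_by_mult:
  assumes "x \<in> carrier G" "y \<in> carrier G" "g \<in> carrier G"
  shows "conj_by G (x \<otimes> y) g = conj_by G x g \<otimes> conj_by G y g"
  using assms by (simp add: m_assoc inv_cancel_left)

lemma (in group) finite_conj_class_mult:
  assumes "x \<in> carrier G" "y \<in> carrier G"
    and "finite (conj_by G x ` carrier G)" "finite (conj_by G y ` carrier G)"
  shows "finite (conj_by G (x \<otimes> y) ` carrier G)"
proof -
  have "conj_by G (x \<otimes> y) ` carrier G
      \<subseteq> (\<lambda>(a, b). a \<otimes> b) ` (conj_by G x ` carrier G \<times> conj_by G y ` carrier G)"
    using assms(1,2) by (auto simp: conj_by_mult)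
  then show ?thesis by (rule finite_subset) (use assms in blast)
qed

lemma (in group) finite_conj_class_pow:
  assumes "x \<in> carrier G" "finite (conj_by G x ` carrier G)"
  shows "finite (conj_by G (x [^] (n::nat)) ` carrier G)"
proof (induction n)
  case 0
  have "conj_by G (x [^] (0::nat)) ` carrier G \<subseteq> {\<one>}" by auto
  then show ?case by (rule finite_subset) simp
next
  case (Suc n)
  then show ?case using assms finite_conj_class_mult[of "x [^] n" x] by simp
qed

lemma (in group) finite_conj_class_inv:
  assumes "x \<in> carrier G" "finite (conj_by G x ` carrier G)"
  shows "finite (conj_by G (inv x) ` carrier G)"
proof -
  have "conj_by G (inv x) ` carrier G = m_inv G ` conj_by G x ` carrier G"
    unfolding image_image
    by (rule image_cong) (use assms(1) in \<open>simp_all add: inv_mult_group m_assoc\<close>)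
  then show ?thesis using assms(2) by simp
qed

lemma (in group) finite_conj_class_conj:
  assumes "x \<in> carrier G" "n \<in> carrier G" "finite (conj_by G x ` carrier G)"
  shows "finite (conj_by G (conj_by G x n) ` carrier G)"
proof -
  have "conj_by G (conj_by G x n) g = conj_by G x (g \<otimes> n)" if "g \<in> carrier G" for g
    using assms that by (simp add: m_assoc inv_mult_group)
  then have "conj_by G (conj_by G x n) ` carrier G \<subseteq> conj_by G x ` carrier G"
    using assms(2) by auto
  then show ?thesis using assms(3) by (rule finite_subset)
qed

text \<open>By the pigeonhole principle two powers \<open>g [^] i\<close> and \<open>g [^] j\<close>
  with \<open>i < j\<close> share a coset of \<open>H\<close>; the exponent is
  \<open>j - i\<close>.\<close>

lemma (in group) finite_index_pow_mem:
  assumes H: "subgroup H G" and fin: "finite (rcosets H)" and g: "g \<in> carrier G"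
  obtains k :: nat where "k > 0" "g [^] k \<in> H"
proof -
  have "(\<lambda>k::nat. H #> g [^] k) ` UNIV \<subseteq> rcosets H" using g by (auto simp: RCOSETS_def)
  then have "\<not> inj (\<lambda>k::nat. H #> g [^] k)"
    using fin finite_subset finite_imageD infinite_UNIV_nat by metis
  then obtain i j :: nat where ij: "i < j" "H #> g [^] i = H #> g [^] j"
    unfolding inj_def by (metis nat_neq_iff)
  have "g [^] j \<in> H #> g [^] i" using rcos_self[OF _ H, of "g [^] j"] g ij by simp
  then have "g [^] j \<otimes> inv (g [^] i) \<in> H"
    using subgroup.rcos_module[OF H is_group] g by simp
  moreover have "g [^] j = g [^] (j - i) \<otimes> g [^] i" using g ij by (simp add: nat_pow_mult)
  ultimately have "g [^] (j - i) \<in> H" using g by (simp add: m_assoc)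
  with ij(1) show thesis by (intro that[of "j - i"]) simp_all
qed

section \<open>Trivial and inner actions on a normal subgroup\<close>

lemma (in normal) conj_aut_eq_one_iff:
  "conj_aut G H g = \<one>\<^bsub>AutoGroup (G\<lparr>carrier := H\<rparr>)\<^esub> \<longleftrightarrow> (\<forall>k\<in>H. g \<otimes> k \<otimes> inv g = k)"
  by (auto simp: conj_aut_def AutoGroup_def BijGroup_def restrict_def fun_eq_iff)

lemma (in normal) conj_aut_in_Inn_iff:
  "conj_aut G H g \<in> Inn (G\<lparr>carrier := H\<rparr>)
     \<longleftrightarrow> (\<exists>n\<in>H. \<forall>k\<in>H. g \<otimes> k \<otimes> inv g = n \<otimes> k \<otimes> inv n)"
proof -
  have "conj_aut (G\<lparr>carrier := H\<rparr>) H n = conj_aut G H n" if "n \<in> H" for n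
    using that by (simp add: conj_aut_def m_inv_consistent[OF subgroup_axioms])
  then have "Inn (G\<lparr>carrier := H\<rparr>) = conj_aut G H ` H" by (simp add: Inn_def)
  moreover have "conj_aut G H g = conj_aut G H n \<longleftrightarrow> (\<forall>k\<in>H. g \<otimes> k \<otimes> inv g = n \<otimes> k \<otimes> inv n)" for n
  proof
    assume eq: "conj_aut G H g = conj_aut G H n"
    show "\<forall>k\<in>H. g \<otimes> k \<otimes> inv g = n \<otimes> k \<otimes> inv n"
    proof
      fix k assume "k \<in> H"
      then show "g \<otimes> k \<otimes> inv g = n \<otimes> k \<otimes> inv n"
        using fun_cong[OF eq, of k] by (simp add: conj_aut_def)
    qed
  qed (simp add: conj_aut_def cong: restrict_cong)
  ultimately show ?thesis by auto
qed

text \<open>Injectivity means trivial kernel, and the coset of \<open>g\<close> is in the kernel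
  exactly when the coset of \<open>conj_aut G H g\<close> modulo the inner automorphisms is
  trivial.\<close>

lemma (in normal) inj_out_map_iff:
  "inj_on (out_map G H) (carrier (G Mod H)) \<longleftrightarrow>
     (\<forall>g \<in> carrier G. conj_aut G H g \<in> Inn (G\<lparr>carrier := H\<rparr>) \<longrightarrow> g \<in> H)"
proof -
  let ?K = "G\<lparr>carrier := H\<rparr>"
  interpret K: group ?K using subgroup_axioms subgroup_is_group[OF is_group] by simp
  interpret I: normal "Inn ?K" "AutoGroup ?K" by (rule K.Inn_normal)
  interpret Q: group "G Mod H" by (rule factorgroup_is_group)
  interpret O: group "Out ?K" unfolding Out_def by (rule I.factorgroup_is_group)
  interpret o: group_hom "G Mod H" "Out ?K" "out_map G H"
    using out_map_hom by unfold_locales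
  have "out_map G H (H #> g) = \<one>\<^bsub>Out ?K\<^esub> \<longleftrightarrow> conj_aut G H g \<in> Inn ?K" if "g \<in> carrier G" for g
    using that I.coset_join1[OF _ hom_in_carrier[OF conj_aut_hom that] I.subgroup_axioms]
      I.coset_join2[OF hom_in_carrier[OF conj_aut_hom that] I.subgroup_axioms]
    by (auto simp: out_map_coset Out_def)
  moreover have "H #> g = H \<longleftrightarrow> g \<in> H" if "g \<in> carrier G" for g
    using that coset_join1 coset_join2 subgroup_axioms subset by blast
  moreover have "carrier (G Mod H) = (\<lambda>g. H #> g) ` carrier G" "\<one>\<^bsub>G Mod H\<^esub> = H"
    by (auto simp: FactGroup_def RCOSETS_def)
  ultimately show ?thesis
    unfolding o.inj_on_one_iff by (simp flip: Ball_def)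
qed

section \<open>The implications between the four conditions\<close>

lemma (in group) icc_finite_index_subgroup:
  assumes H: "subgroup H G" and fin: "finite (rcosets H)" and "icc G"
  shows "icc (G\<lparr>carrier := H\<rparr>)"
proof -
  have G: "infinite (carrier G)" "\<And>x. x \<in> carrier G \<Longrightarrow> finite (conj_by G x ` carrier G) \<Longrightarrow> x = \<one>"
    using assms(3) icc_iff by auto
  have "infinite H"
  proof
    assume "finite H"
    then have "finite C" if "C \<in> rcosets H" for C
      using that by (auto simp: RCOSETS_def r_coset_def)
    then have "finite (\<Union>(rcosets H))" using fin by blast
    then show False using G(1) rcosets_part_G[OF H] by simp
  qed
  then show ?thesis
    using G(2) finite_conj_class_if_finite_index[OF H fin] subgroup.mem_carrier[OF H]
    by (auto simp: icc_subgroup_iff[OF H])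
qed

lemma (in normal) inner_imp_mem_if_icc:
  assumes fin: "finite (rcosets H)" and "icc G" and g: "g \<in> carrier G"
    and inn: "conj_aut G H g \<in> Inn (G\<lparr>carrier := H\<rparr>)"
  shows "g \<in> H"
proof -
  obtain n where n: "n \<in> H" "\<And>k. k \<in> H \<Longrightarrow> g \<otimes> k \<otimes> inv g = n \<otimes> k \<otimes> inv n"
    using inn conj_aut_in_Inn_iff by auto
  \<comment> \<open>Since \<open>g\<close> and \<open>n\<close> act alike on \<open>H\<close>, the
    element \<open>z\<close> centralizes \<open>H\<close>. Its orbit under \<open>H\<close> is then
    \<open>{z}\<close>, so \<open>z\<close> is FC in \<open>G\<close>.\<close>
  define z where "z = inv n \<otimes> g"
  have nc: "n \<in> carrier G" and z: "z \<in> carrier G" using n g by (auto simp: z_def)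
  have "conj_by G z k = z" if k: "k \<in> H" for k
  proof -
    have kc: "k \<in> carrier G" using k by simp
    have "z \<otimes> k \<otimes> inv z = inv n \<otimes> (g \<otimes> k \<otimes> inv g) \<otimes> n"
      using nc g kc by (simp add: z_def m_assoc inv_mult_group)
    also have "\<dots> = k" using n(2)[OF k] nc kc by (simp add: m_assoc inv_cancel_left)
    finally have "z \<otimes> k = k \<otimes> z" using inv_solve_right'[of k "z \<otimes> k" z] z kc by simp
    then have "conj_by G z k = z \<otimes> k \<otimes> inv k" by simp
    then show ?thesis using z kc by (simp add: m_assoc)
  qed
  then have "conj_by G z ` H \<subseteq> {z}" by auto
  then have "finite (conj_by G z ` carrier G)"
    using finite_conj_class_if_finite_index[OF subgroup_axioms fin z] finite_subset by blast
  then have "z = \<one>" using \<open>icc G\<close> z icc_iff by blast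
  then have "g = n" using nc g unfolding z_def by (metis inv_equality inv_inv inv_closed)
  then show ?thesis using n by simp
qed

lemma (in group) icc_if_torsion_acts_nontrivially:
  assumes H: "subgroup H G" and fin: "finite (rcosets H)" and iccH: "icc (G\<lparr>carrier := H\<rparr>)"
    and N: "N \<lhd> G" "N \<subseteq> H"
    and tors: "\<And>g. g \<in> carrier G - H \<Longrightarrow> has_finite_order G g \<Longrightarrow>
      conj_aut G N g \<noteq> \<one>\<^bsub>AutoGroup (G\<lparr>carrier := N\<rparr>)\<^esub>"
  shows "icc G"
proof -
  interpret N: normal N G by (rule N)
  have inf: "infinite H" and Hone: "\<And>x. x \<in> H \<Longrightarrow> finite (conj_by G x ` H) \<Longrightarrow> x = \<one>"
    using iccH icc_subgroup_iff[OF H] by auto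
  have FC: "x = \<one>" if "x \<in> H" "finite (conj_by G x ` carrier G)" for x
    using that Hone subgroup.subset[OF H] by (meson finite_subset image_mono)
  have "g = \<one>" if g: "g \<in> carrier G" and gfin: "finite (conj_by G g ` carrier G)" for g
  proof (rule ccontr)
    assume "g \<noteq> \<one>"
    then have gH: "g \<in> carrier G - H" using FC g gfin by blast
    obtain k :: nat where k: "k > 0" "g [^] k \<in> H" by (rule finite_index_pow_mem[OF H fin g])
    have "g [^] k = \<one>" using FC[OF k(2)] finite_conj_class_pow[OF g gfin] by blast
    \<comment> \<open>The order divides \<open>k\<close>, and 0 does not divide a positive
      number.\<close>
    then have "has_finite_order G g"
      using k(1) pow_eq_id[OF g] unfolding has_finite_order_def by auto
    moreover have "g \<otimes> n \<otimes> inv g = n" if n: "n \<in> N" for n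
    proof -
      have nc: "n \<in> carrier G" using n by simp
      \<comment> \<open>The commutator is read in two ways: as a conjugate of \<open>n\<close> times
        \<open>inv n\<close> it lies in the normal subgroup \<open>N\<close>; as \<open>g\<close>
        times a conjugate of \<open>inv g\<close> it is FC. Being an FC element of \<open>H\<close>,
        it is trivial.\<close>
      have "(g \<otimes> n \<otimes> inv g) \<otimes> inv n \<in> N"
        using n g N.inv_op_closed2 by simp
      moreover have "(g \<otimes> n \<otimes> inv g) \<otimes> inv n = g \<otimes> conj_by G (inv g) n"
        using g nc by (simp add: m_assoc)
      moreover have "finite (conj_by G (g \<otimes> conj_by G (inv g) n) ` carrier G)"
        using g nc gfin by (intro finite_conj_class_mult finite_conj_class_conj finite_conj_class_inv) auto
      ultimately have "(g \<otimes> n \<otimes> inv g) \<otimes> inv n = \<one>" using FC N(2) by (metis subsetD)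
      then show ?thesis using inv_equality[of "g \<otimes> n \<otimes> inv g" "inv n"] g nc by simp
    qed
    ultimately show False using tors[OF gH] N.conj_aut_eq_one_iff by blast
  qed
  moreover have "infinite (carrier G)" using inf subgroup.subset[OF H] finite_subset by blast
  ultimately show ?thesis by (simp add: icc_iff)
qed

theorem proposition5p3:
  fixes G :: "('a, 'b) monoid_scheme" and H N :: "'a set"
  assumes "group G" and "subgroup H G" and "finite (rcosets\<^bsub>G\<^esub> H)"
    and "N = normal_core G H"
  shows
    "(icc G \<longleftrightarrow>
        icc (G\<lparr>carrier := H\<rparr>) \<and> inj_on (out_map G N) (carrier (G Mod N)))
   \<and> (icc G \<longleftrightarrow>
        icc (G\<lparr>carrier := H\<rparr>) \<and>
        (\<forall>g \<in> carrier G - H. has_finite_order G g \<longrightarrow>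
           conj_aut G N g \<noteq> \<one>\<^bsub>AutoGroup (G\<lparr>carrier := N\<rparr>)\<^esub>))
   \<and> (icc G \<longleftrightarrow>
        icc (G\<lparr>carrier := H\<rparr>) \<and>
        (\<forall>g \<in> carrier G - H. has_finite_order G g \<longrightarrow>
           conj_aut G N g \<notin> Inn (G\<lparr>carrier := N\<rparr>)))"
proof -
  interpret group G by fact
  note H = \<open>subgroup H G\<close> and fin = \<open>finite (rcosets\<^bsub>G\<^esub> H)\<close>
  interpret N: normal N G unfolding \<open>N = _\<close> using H by (rule normal_core_normal)
  have NH: "N \<subseteq> H" unfolding \<open>N = _\<close> using H by (rule normal_core_subset)
  have finN: "finite (rcosets\<^bsub>G\<^esub> N)" unfolding \<open>N = _\<close> using H fin by (rule finite_index_normal_core)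
  let ?inj = "inj_on (out_map G N) (carrier (G Mod N))"
  let ?nontrivial = "\<forall>g \<in> carrier G - H. has_finite_order G g \<longrightarrow>
           conj_aut G N g \<noteq> \<one>\<^bsub>AutoGroup (G\<lparr>carrier := N\<rparr>)\<^esub>"
  let ?outer = "\<forall>g \<in> carrier G - H. has_finite_order G g \<longrightarrow>
           conj_aut G N g \<notin> Inn (G\<lparr>carrier := N\<rparr>)"
  \<comment> \<open>The equivalences follow from a cycle: icc of \<open>G\<close> gives
    \<open>?inj\<close>, then \<open>?outer\<close>, then \<open>?nontrivial\<close>, which together
    with icc of \<open>H\<close> leads back to icc of \<open>G\<close>.\<close>
  have "icc G \<Longrightarrow> icc (G\<lparr>carrier := H\<rparr>)" by (rule icc_finite_index_subgroup[OF H fin])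
  moreover have "icc G \<Longrightarrow> ?inj"
    using N.inner_imp_mem_if_icc[OF finN] N.inj_out_map_iff by blast
  \<comment> \<open>An inner action would force \<open>g\<close> into \<open>N\<close>, hence into
    \<open>H\<close>.\<close>
  moreover have "?inj \<Longrightarrow> ?outer" using NH N.inj_out_map_iff by blast
  moreover have "?outer \<Longrightarrow> ?nontrivial"
  proof -
    \<comment> \<open>A trivial action is inner: it is conjugation by \<open>\<one>\<close>, an
      element of \<open>N\<close>.\<close>
    have "conj_by G k g = conj_by G k \<one>\<^bsub>G\<^esub>" if "conj_by G k g = k" "k \<in> N" for g k
      using that by simp
    then show "?outer \<Longrightarrow> ?nontrivial"
      unfolding N.conj_aut_eq_one_iff N.conj_aut_in_Inn_iff using N.one_closed by metis
  qed
  moreover have "icc (G\<lparr>carrier := H\<rparr>) \<Longrightarrow> ?nontrivial \<Longrightarrow> icc G"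
    by (rule icc_if_torsion_acts_nontrivially[OF H fin _ N.normal_axioms NH]) auto
  ultimately show ?thesis by blast
qed

end
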